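(* For any integer $m\geq 0$, $d_{\mathrm{GH}}(\mathbb{S}^m,\mathbb{S}^\infty)=\frac{\pi}{2}$.
   Context: For an integer $m\ge 0$, $\mathbb{S}^m=\{x\in\mathbb{R}^{m+1}:\|x\|=1\}$ is the unit sphere with the geodesic distance $d_{\mathbb{S}^m}(x,x')=\arccos\langle x,x'\rangle$ (so $\mathbb{S}^0$ is two points at distance $\pi$). $\mathbb{S}^\infty$ is the unit sphere of the real Hilbert space $\ell^2$ with the distance $d(x,x')=\arccos\langle x,x'\rangle$. The Gromov-Hausdorff distance between bounded metric spaces $X,Y$ is $d_{\mathrm{GH}}(X,Y)=\inf d_{\mathrm{H}}(f(X),g(Y))$, the infimum being over all metric spaces $Z$ and all isometric (distance-preserving) embeddings $f:X\to Z$, $g:Y\to Z$, with $d_{\mathrm{H}}$ the Hausdorff distance in $Z$. Equivalently $d_{\mathrm{GH}}(X,Y)=\frac12\inf_R \operatorname{dis}(R)$, where $R\subseteq X\times Y$ ranges over correspondences (relations whose projections to $X$ and to $Y$ are both surjective) and $\operatorname{dis}(R)=\sup_{(x,y),(x',y')\in R}|d_X(x,x')-d_Y(y,y')|$. *)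

theory Defs
  imports "HOL-Analysis.Analysis"
begin

section \<open>The Hilbert space of square-summable real sequences\<close>

typedef ell2 = "{x :: nat \<Rightarrow> real. summable (\<lambda>i. (x i)\<^sup>2)}"
  morphisms ell2_nth Abs_ell2
  by (rule exI[of _ "\<lambda>_. 0"]) simp

setup_lifting type_definition_ell2

lemma summable_mult_of_squares:
  fixes x y :: "nat \<Rightarrow> real"
  assumes "summable (\<lambda>i. (x i)\<^sup>2)" "summable (\<lambda>i. (y i)\<^sup>2)"
  shows "summable (\<lambda>i. x i * y i)"
proof (rule summable_comparison_test')
  show "summable (\<lambda>i. (x i)\<^sup>2 + (y i)\<^sup>2)"
    using assms by (rule summable_add)
  show "norm (x i * y i) \<le> (x i)\<^sup>2 + (y i)\<^sup>2" if "0 \<le> i" for i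
  proof -
    have "2 * (\<bar>x i\<bar> * \<bar>y i\<bar>) \<le> (x i)\<^sup>2 + (y i)\<^sup>2"
      using sum_squares_bound[of "\<bar>x i\<bar>" "\<bar>y i\<bar>"] by simp
    moreover have "0 \<le> \<bar>x i\<bar> * \<bar>y i\<bar>" by simp
    ultimately show ?thesis unfolding real_norm_def abs_mult by linarith
  qed
qed

lemma summable_square_add:
  fixes x y :: "nat \<Rightarrow> real"
  assumes "summable (\<lambda>i. (x i)\<^sup>2)" "summable (\<lambda>i. (y i)\<^sup>2)"
  shows "summable (\<lambda>i. (x i + y i)\<^sup>2)"
proof -
  have "summable (\<lambda>i. (x i)\<^sup>2 + (y i)\<^sup>2 + 2 * (x i * y i))"
    by (intro summable_add summable_mult summable_mult_of_squares assms)
  then show ?thesis by (simp add: power2_sum mult.assoc)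
qed

lemma summable_square_diff:
  fixes x y :: "nat \<Rightarrow> real"
  assumes "summable (\<lambda>i. (x i)\<^sup>2)" "summable (\<lambda>i. (y i)\<^sup>2)"
  shows "summable (\<lambda>i. (x i - y i)\<^sup>2)"
  using summable_square_add[of x "\<lambda>i. - y i"] assms by simp

instantiation ell2 :: real_inner
begin

lift_definition zero_ell2 :: ell2 is "\<lambda>_. 0" by simp

lift_definition plus_ell2 :: "ell2 \<Rightarrow> ell2 \<Rightarrow> ell2" is "\<lambda>x y i. x i + y i"
  by (rule summable_square_add)

lift_definition minus_ell2 :: "ell2 \<Rightarrow> ell2 \<Rightarrow> ell2" is "\<lambda>x y i. x i - y i"
  by (rule summable_square_diff)

lift_definition uminus_ell2 :: "ell2 \<Rightarrow> ell2" is "\<lambda>x i. - x i" by simp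

lift_definition scaleR_ell2 :: "real \<Rightarrow> ell2 \<Rightarrow> ell2" is "\<lambda>r x i. r * x i"
  by (simp add: power_mult_distrib summable_mult)

lift_definition inner_ell2 :: "ell2 \<Rightarrow> ell2 \<Rightarrow> real" is "\<lambda>x y. \<Sum>i. x i * y i" .

definition norm_ell2 :: "ell2 \<Rightarrow> real" where
  "norm_ell2 x = sqrt (inner x x)"

definition sgn_ell2 :: "ell2 \<Rightarrow> ell2" where
  "sgn_ell2 x = inverse (norm x) *\<^sub>R x"

definition dist_ell2 :: "ell2 \<Rightarrow> ell2 \<Rightarrow> real" where
  "dist_ell2 x y = norm (x - y)"

definition uniformity_ell2 :: "(ell2 \<times> ell2) filter" where
  "uniformity_ell2 = (INF e\<in>{0<..}. principal {(x, y). dist x y < e})"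

definition open_ell2 :: "ell2 set \<Rightarrow> bool" where
  "open_ell2 U \<longleftrightarrow> (\<forall>x\<in>U. eventually (\<lambda>(x', y). x' = x \<longrightarrow> y \<in> U) uniformity)"

instance
proof
  fix x y z :: ell2 and r s :: real and U :: "ell2 set"
  show "x + y + z = x + (y + z)" by transfer (simp add: add.assoc)
  show "x + y = y + x" by transfer (simp add: add.commute)
  show "0 + x = x" by transfer simp
  show "- x + x = 0" by transfer simp
  show "x - y = x + - y" by transfer simp
  show "r *\<^sub>R (x + y) = r *\<^sub>R x + r *\<^sub>R y" by transfer (simp add: distrib_left)
  show "(r + s) *\<^sub>R x = r *\<^sub>R x + s *\<^sub>R x" by transfer (simp add: distrib_right)
  show "r *\<^sub>R s *\<^sub>R x = (r * s) *\<^sub>R x" by transfer (simp add: mult.assoc)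
  show "1 *\<^sub>R x = x" by transfer simp
  show "sgn x = inverse (norm x) *\<^sub>R x" by (rule sgn_ell2_def)
  show "dist x y = norm (x - y)" by (rule dist_ell2_def)
  show "uniformity = (INF e\<in>{0<..}. principal {(x :: ell2, y). dist x y < e})"
    by (rule uniformity_ell2_def)
  show "open U \<longleftrightarrow> (\<forall>x\<in>U. eventually (\<lambda>(x', y). x' = x \<longrightarrow> y \<in> U) uniformity)"
    by (rule open_ell2_def)
  show "inner x y = inner y x" by transfer (simp add: mult.commute)
  show "inner (x + y) z = inner x z + inner y z"
    by transfer (simp add: distrib_right suminf_add summable_mult_of_squares)
  show "inner (r *\<^sub>R x) y = r * inner x y"
    by transfer (simp add: mult.assoc suminf_mult summable_mult_of_squares)
  show "0 \<le> inner x x"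
    by transfer (auto intro!: suminf_nonneg simp: summable_mult_of_squares)
  show "inner x x = 0 \<longleftrightarrow> x = 0"
  proof transfer
    fix x :: "nat \<Rightarrow> real"
    assume "summable (\<lambda>i. (x i)\<^sup>2)"
    then have "(\<Sum>i. x i * x i) = 0 \<longleftrightarrow> (\<forall>i. x i * x i = 0)"
      by (intro suminf_eq_zero_iff) (auto simp: power2_eq_square)
    then show "(\<Sum>i. x i * x i) = 0 \<longleftrightarrow> x = (\<lambda>_. 0)" by auto
  qed
  show "norm x = sqrt (inner x x)" by (rule norm_ell2_def)
qed

end

section \<open>Unit spheres with the geodesic distance\<close>

lemma abs_inner_unit_le_1:
  fixes x y :: "'a::real_inner"
  assumes "norm x = 1" "norm y = 1"
  shows "\<bar>inner x y\<bar> \<le> 1"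
  using Cauchy_Schwarz_ineq2[of x y] assms by simp

lemma arccos_inner_triangle:
  fixes x y z :: "'a::real_inner"
  assumes "norm x = 1" "norm y = 1" "norm z = 1"
  shows "arccos (inner x z) \<le> arccos (inner x y) + arccos (inner y z)"
proof (cases "arccos (inner x y) + arccos (inner y z) \<le> pi")
  case False
  moreover have "arccos (inner x z) \<le> pi"
    using abs_inner_unit_le_1[OF assms(1,3)] by (intro arccos_ubound) auto
  ultimately show ?thesis by linarith
next
  case True
  define a b where "a = inner x y" and "b = inner y z"
  have a: "\<bar>a\<bar> \<le> 1" and b: "\<bar>b\<bar> \<le> 1" and c: "\<bar>inner x z\<bar> \<le> 1"
    unfolding a_def b_def using assms by (auto intro: abs_inner_unit_le_1)
  have sq: "inner x x = 1" "inner y y = 1" "inner z z = 1"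
    using assms by (auto simp: norm_eq_1)
  define u v where "u = x - a *\<^sub>R y" and "v = z - b *\<^sub>R y"
  have "inner u u = 1 - a\<^sup>2"
    by (simp add: u_def a_def inner_diff_left inner_diff_right sq inner_commute power2_eq_square)
  moreover have "inner v v = 1 - b\<^sup>2"
    by (simp add: v_def b_def inner_diff_left inner_diff_right sq inner_commute power2_eq_square)
  moreover have uv: "inner u v = inner x z - a * b"
    by (simp add: u_def v_def a_def b_def inner_diff_left inner_diff_right sq inner_commute)
  moreover have "- (norm u * norm v) \<le> inner u v"
    using Cauchy_Schwarz_ineq2[of u v] by linarith
  ultimately have "a * b - sqrt (1 - a\<^sup>2) * sqrt (1 - b\<^sup>2) \<le> inner x z"
    by (simp add: norm_eq_sqrt_inner)
  then have "cos (arccos a + arccos b) \<le> cos (arccos (inner x z))"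
    using a b c by (simp add: cos_add sin_arccos_abs)
  moreover have "0 \<le> arccos a + arccos b"
    using a b by (intro add_nonneg_nonneg arccos_lbound) auto
  moreover have "0 \<le> arccos (inner x z)" "arccos (inner x z) \<le> pi"
    using c by (auto intro: arccos_lbound arccos_ubound)
  ultimately show ?thesis
    using True unfolding a_def b_def by (subst (asm) cos_mono_le_eq) auto
qed

text \<open>The value \<open>0\<close> off the sphere is a dummy: the type of metrics asks for
  nonnegativity and symmetry of the distance function outside the carrier as well.\<close>

definition geodesic_dist :: "'a::real_inner \<Rightarrow> 'a \<Rightarrow> real" where
  "geodesic_dist x y =
     (if x \<in> sphere 0 1 \<and> y \<in> sphere 0 1 then arccos (inner x y) else 0)"

lemma Metric_space_geodesic: "Metric_space (sphere (0 :: 'a::real_inner) 1) geodesic_dist"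
proof
  fix x y z :: 'a
  show "0 \<le> geodesic_dist x y"
    using abs_inner_unit_le_1[of x y] by (auto simp: geodesic_dist_def intro!: arccos_lbound)
  show "geodesic_dist x y = geodesic_dist y x"
    by (auto simp: geodesic_dist_def inner_commute)
  show "geodesic_dist x y = 0 \<longleftrightarrow> x = y" if "x \<in> sphere 0 1" "y \<in> sphere 0 1"
  proof
    have n: "norm x = 1" "norm y = 1" using that by auto
    then have sq: "inner x x = 1" "inner y y = 1" by (auto simp: norm_eq_1)
    show "geodesic_dist x y = 0" if "x = y"
      using n sq that by (simp add: geodesic_dist_def)
    assume "geodesic_dist x y = 0"
    then have "arccos (inner x y) = 0" using that by (simp add: geodesic_dist_def)
    then have "inner x y = 1"
      using cos_arccos_abs[OF abs_inner_unit_le_1[OF n]] by simp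
    then have "inner (x - y) (x - y) = 0"
      by (simp add: inner_diff_left inner_diff_right sq inner_commute)
    then show "x = y" by simp
  qed
  show "geodesic_dist x z \<le> geodesic_dist x y + geodesic_dist y z"
    if "x \<in> sphere 0 1" "y \<in> sphere 0 1" "z \<in> sphere 0 1"
    using that arccos_inner_triangle[of x y z] by (simp add: geodesic_dist_def)
qed

definition unit_sphere :: "'a::real_inner metric" where
  "unit_sphere = metric (sphere 0 1, geodesic_dist)"

lemma mspace_unit_sphere [simp]: "mspace unit_sphere = sphere 0 1"
  unfolding unit_sphere_def by (rule Metric_space.mspace_metric[OF Metric_space_geodesic])

lemma mdist_unit_sphere:
  "x \<in> sphere 0 1 \<Longrightarrow> y \<in> sphere 0 1 \<Longrightarrow> mdist unit_sphere x y = arccos (inner x y)"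
  unfolding unit_sphere_def
  by (simp add: Metric_space.mdist_metric[OF Metric_space_geodesic] geodesic_dist_def)

section \<open>Hausdorff and Gromov-Hausdorff distance\<close>

text \<open>Real-valued, hence meaningful for nonempty bounded sets only: elsewhere the suprema
  and infima in \<open>real\<close> need not exist and have unspecified values.\<close>

definition hausdorff_dist :: "'a metric \<Rightarrow> 'a set \<Rightarrow> 'a set \<Rightarrow> real" where
  "hausdorff_dist Z A B =
     max (SUP a\<in>A. INF b\<in>B. mdist Z a b) (SUP b\<in>B. INF a\<in>A. mdist Z a b)"

definition isometric_embedding :: "('a \<Rightarrow> 'b) \<Rightarrow> 'a metric \<Rightarrow> 'b metric \<Rightarrow> bool" where
  "isometric_embedding f X Z \<longleftrightarrow>
     f ` mspace X \<subseteq> mspace Z \<and>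
     (\<forall>x\<in>mspace X. \<forall>y\<in>mspace X. mdist Z (f x) (f y) = mdist X x y)"

text \<open>A definition cannot quantify over the type of points of the ambient space \<open>Z\<close>. The sum
  type is large enough: only the points of \<open>f(X) \<union> g(Y)\<close> matter, and these inject
  into \<open>'a + 'b\<close>. Lemma \<open>hausdorff_dist_embedded\<close> below shows that ambient spaces over
  arbitrary types contribute no further values.\<close>

definition GH_dist :: "'a metric \<Rightarrow> 'b metric \<Rightarrow> real" where
  "GH_dist X Y =
     Inf {hausdorff_dist Z (f ` mspace X) (g ` mspace Y) | (Z :: ('a + 'b) metric) f g.
            isometric_embedding f X Z \<and> isometric_embedding g Y Z}"

lemma hausdorff_dist_image:
  assumes "\<And>a b. a \<in> A \<Longrightarrow> b \<in> B \<Longrightarrow> mdist Z' (h a) (h b) = mdist Z a b"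
  shows "hausdorff_dist Z' (h ` A) (h ` B) = hausdorff_dist Z A B"
proof -
  have "(\<lambda>a. INF b\<in>B. mdist Z' (h a) (h b)) ` A = (\<lambda>a. INF b\<in>B. mdist Z a b) ` A"
    using assms by (intro image_cong refl arg_cong[where f = Inf]) auto
  moreover have "(\<lambda>b. INF a\<in>A. mdist Z' (h a) (h b)) ` B = (\<lambda>b. INF a\<in>A. mdist Z a b) ` B"
    using assms by (intro image_cong refl arg_cong[where f = Inf]) auto
  ultimately show ?thesis by (simp add: hausdorff_dist_def image_image)
qed

lemma hausdorff_dist_embedded:
  fixes X :: "'a metric" and Y :: "'b metric" and Z :: "'c metric"
  assumes f: "isometric_embedding f X Z" and g: "isometric_embedding g Y Z"
  shows "\<exists>(Z' :: ('a + 'b) metric) f' g'.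
           isometric_embedding f' X Z' \<and> isometric_embedding g' Y Z' \<and>
           hausdorff_dist Z' (f' ` mspace X) (g' ` mspace Y) =
           hausdorff_dist Z (f ` mspace X) (g ` mspace Y)"
proof -
  define I where "I = f ` mspace X \<union> g ` mspace Y"
  have IZ: "I \<subseteq> mspace Z"
    using f g by (auto simp: I_def isometric_embedding_def)
  define h :: "'c \<Rightarrow> 'a + 'b" where
    "h z = (if z \<in> f ` mspace X then Inl (inv_into (mspace X) f z)
            else Inr (inv_into (mspace Y) g z))" for z
  have h: "inj_on h I"
    unfolding inj_on_def
  proof (intro ballI impI)
    fix z w assume "z \<in> I" "w \<in> I" "h z = h w"
    then show "z = w"
      by (auto simp: h_def I_def split: if_splits dest: inv_into_injective)
  qed
  define k where "k = inv_into I h"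
  have kh: "k (h z) = z" if "z \<in> I" for z
    unfolding k_def using h that by simp
  define d where
    "d p q = (if p \<in> h ` I \<and> q \<in> h ` I then mdist Z (k p) (k q) else 0)" for p q
  interpret Z: Metric_space "mspace Z" "mdist Z" by simp
  interpret D: Metric_space "h ` I" d
  proof
    fix p q r
    show "0 \<le> d p q" by (simp add: d_def)
    show "d p q = d q p" by (simp add: d_def Z.commute)
    show "d p q = 0 \<longleftrightarrow> p = q" if "p \<in> h ` I" "q \<in> h ` I"
      using that IZ by (auto simp: d_def kh subset_iff)
    show "d p r \<le> d p q + d q r" if "p \<in> h ` I" "q \<in> h ` I" "r \<in> h ` I"
      using that IZ by (auto simp: d_def kh subset_iff intro!: Z.triangle)
  qed
  define Z' where "Z' = metric (h ` I, d)"
  have Z': "mspace Z' = h ` I" "mdist Z' = d" by (simp_all add: Z'_def)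
  have dh: "d (h z) (h w) = mdist Z z w" if "z \<in> I" "w \<in> I" for z w
    using that by (simp add: d_def kh)
  have "isometric_embedding (h \<circ> f) X Z'" "isometric_embedding (h \<circ> g) Y Z'"
    using f g by (auto simp: isometric_embedding_def Z' dh I_def)
  moreover have "hausdorff_dist Z' ((h \<circ> f) ` mspace X) ((h \<circ> g) ` mspace Y) =
      hausdorff_dist Z (f ` mspace X) (g ` mspace Y)"
    unfolding image_comp[symmetric]
    by (rule hausdorff_dist_image) (auto simp: Z' I_def intro!: dh)
  ultimately show ?thesis by blast
qed

end

theory Submission
  imports Defs
begin

text \<open>
  The upper bound is soft: both spheres have diameter at most \<open>\<pi>\<close>, so placing them side by side
  with all cross distances equal to \<open>\<pi> / 2\<close> gives a metric space in which their Hausdorff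
  distance is \<open>\<pi> / 2\<close> (\<open>glue_at_constant_distance\<close>).

  For the lower bound, suppose that \<open>S^m\<close> and the Hilbert sphere sit in a common space at Hausdorff
  distance less than \<open>s < \<pi> / 2\<close>. By compactness there is a finite net \<open>K\<close> in \<open>S^m\<close> such that every
  point of the Hilbert sphere is within \<open>s\<close> of some point of \<open>K\<close>. Colouring each point by such a net
  point colours the Hilbert sphere with finitely many colours so that points of equal colour are at
  distance less than \<open>2 * s < \<pi>\<close>. This is impossible: in any finite colouring of the Hilbert
  sphere some colour contains pairs at distance arbitrarily close to \<open>\<pi>\<close>
  (\<open>finite_colouring_nearly_antipodal\<close>).

  The latter is a weak form of the Lyusternik-Schnirelmann theorem. Since the dimension may be
  as large as desired, concentration of measure replaces topology. Scaled by
  \<open>1 / sqrt n\<close>, the sign vectors of length \<open>n\<close> lie on the Hilbert sphere, and two of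
  them are nearly antipodal exactly when they differ in nearly all coordinates. One of
  the \<open>N\<close> colours contains a fraction at least \<open>1 / N\<close> of the \<open>2 ^ n\<close> sign vectors. If no two vectors
  of this class \<open>A\<close> were nearly antipodal, then \<open>A\<close> and \<open>- A\<close> would be at a Hamming distance
  proportional to \<open>n\<close>, and by \<open>card_mult_separated_le\<close> such pairs of sets occupy an exponentially
  small proportion of the cube.
\<close>

section \<open>Separated subsets of the discrete cube\<close>

definition cube :: "nat \<Rightarrow> bool list set" where
  "cube n = {xs. length xs = n}"

definition hamming :: "bool list \<Rightarrow> bool list \<Rightarrow> nat" where
  "hamming xs ys = length (filter (\<lambda>(x, y). x \<noteq> y) (zip xs ys))"

lemma hamming_simps [simp]:
  "hamming [] ys = 0"
  "hamming (x # xs) (y # ys) = (if x = y then 0 else 1) + hamming xs ys"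
  by (auto simp: hamming_def)

lemma finite_cube [simp]: "finite (cube n)"
  and card_cube: "card (cube n) = 2 ^ n"
  using finite_lists_length_eq[of "UNIV :: bool set" n] card_lists_length_eq[of "UNIV :: bool set" n]
  by (simp_all add: cube_def)

lemma hamming_map_Not:
  assumes "length xs = length ys"
  shows "hamming xs (map Not ys) + hamming xs ys = length xs"
  using assms by (induction xs ys rule: list_induct2) auto

lemma card_cube_Suc:
  assumes "A \<subseteq> cube (Suc n)"
  shows "card A = card {xs. True # xs \<in> A} + card {xs. False # xs \<in> A}"
    and "{xs. x # xs \<in> A} \<subseteq> cube n"
proof -
  have sub: "{xs. x # xs \<in> A} \<subseteq> cube n" for x
    using assms by (auto simp: cube_def)
  then show "{xs. x # xs \<in> A} \<subseteq> cube n" .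
  have fin: "finite {xs. x # xs \<in> A}" for x
    using sub finite_cube by (rule finite_subset)
  have "A = (#) True ` {xs. True # xs \<in> A} \<union> (#) False ` {xs. False # xs \<in> A}"
  proof (rule set_eqI)
    fix ys
    show "ys \<in> A \<longleftrightarrow> ys \<in> (#) True ` {xs. True # xs \<in> A} \<union> (#) False ` {xs. False # xs \<in> A}"
    proof (cases ys)
      case Nil
      then show ?thesis using assms by (auto simp: cube_def)
    next
      case (Cons y zs)
      then show ?thesis by (cases y) auto
    qed
  qed
  then have "card A = card ((#) True ` {xs. True # xs \<in> A} \<union> (#) False ` {xs. False # xs \<in> A})"
    by simp
  also have "\<dots> = card ((#) True ` {xs. True # xs \<in> A}) + card ((#) False ` {xs. False # xs \<in> A})"
    by (rule card_Un_disjoint) (use fin in auto)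
  also have "\<dots> = card {xs. True # xs \<in> A} + card {xs. False # xs \<in> A}"
    by (simp add: card_image)
  finally show "card A = card {xs. True # xs \<in> A} + card {xs. False # xs \<in> A}" .
qed

text \<open>
  The factor \<open>F + 1 / F\<close>, rather than the \<open>2 * F\<close> obtained by adding the two individual bounds,
  is what makes the induction below effective: it exceeds \<open>2\<close> only to second order in \<open>F - 1\<close>.
\<close>
lemma add_le_of_mult_le:
  fixes p q F M :: real
  assumes "F \<ge> 1" "M > 0" "p \<le> F * M" "q \<le> F * M" "p * q \<le> M * M"
  shows "p + q \<le> (F + 1 / F) * M"
proof -
  \<comment> \<open>With a fixed bound on \<open>p * q\<close>, the sum is largest at the extreme point
    \<open>p = F * M\<close>, \<open>q = M / F\<close>; the expanded product below is that convexity argument.\<close>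
  have "0 \<le> (F * M - p) * (F * M - q)"
    using assms by simp
  then have "(F * M) * (p + q) \<le> (F * M) * (F * M) + M * M"
    using assms(5) by (simp add: algebra_simps)
  also have "\<dots> = (F * M) * ((F + 1 / F) * M)"
    using assms by (simp add: field_simps)
  finally show ?thesis
    using assms by (simp add: mult_le_cancel_left)
qed

text \<open>
  Concentration of measure in the cube, by induction on the dimension. Cut \<open>A\<close> and \<open>B\<close> along the first
  coordinate. Halves on the same side are still at distance \<open>d\<close>, halves on opposite sides at
  distance \<open>d - 1\<close>, which costs a factor \<open>F\<close> in the bound. The two
  opposite-side products cannot both be this large, though, since their product equals
  that of the two same-side products. The distance \<open>d\<close> is an integer so that
  the step from \<open>d\<close> to \<open>d - 1\<close> needs no lower limit.
\<close>
lemma card_mult_separated_le: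
  fixes F :: real and d :: int
  assumes "F \<ge> 1" and "A \<subseteq> cube n" "B \<subseteq> cube n"
    and "\<And>a b. a \<in> A \<Longrightarrow> b \<in> B \<Longrightarrow> d \<le> int (hamming a b)"
  shows "real (card A) * real (card B) \<le> (2 + F + 1 / F) ^ n * F powi (- d)"
  using assms(2-)
proof (induction n arbitrary: A B d)
  case 0
  then have sub: "A \<subseteq> {[]}" "B \<subseteq> {[]}" by (auto simp: cube_def)
  show ?case
  proof (cases "A = {} \<or> B = {}")
    case True
    then show ?thesis using assms(1) by auto
  next
    case False
    then have AB: "A = {[]}" "B = {[]}" using sub by auto
    then have "d \<le> 0" using "0.prems"(3)[of "[]" "[]"] by simp
    then have "F powi (- d) \<ge> 1"
      using assms(1) by (simp add: power_int_def)
    then show ?thesis by (simp add: AB)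
  qed
next
  case (Suc n)
  define C where "C = 2 + F + 1 / F"
  define M where "M = C ^ n * F powi (- d)"
  have "C > 0" using assms(1) by (simp add: C_def add_pos_pos)
  then have M: "M > 0" using assms(1) by (simp add: M_def)
  define a where "a x = real (card {xs. x # xs \<in> A})" for x
  define b where "b x = real (card {xs. x # xs \<in> B})" for x
  note A = card_cube_Suc[OF Suc.prems(1)] and B = card_cube_Suc[OF Suc.prems(2)]
  have same: "a x * b x \<le> M" for x
    unfolding a_def b_def M_def C_def
    by (rule Suc.IH[OF A(2) B(2)]) (use Suc.prems(3)[of "x # _" "x # _"] in auto)
  have diff: "a x * b y \<le> F * M" if "x \<noteq> y" for x y
  proof -
    have "a x * b y \<le> C ^ n * F powi (- (d - 1))"
      unfolding a_def b_def C_def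
      by (rule Suc.IH[OF A(2) B(2)]) (use Suc.prems(3)[of "x # _" "y # _"] that in force)
    also have "F powi (- (d - 1)) = F * F powi (- d)"
      using assms(1) power_int_add[of F 1 "- d"] by simp
    finally show ?thesis by (simp add: M_def mult_ac)
  qed
  have "(a True * b False) * (a False * b True) = (a True * b True) * (a False * b False)"
    by (simp add: mult_ac)
  also have "\<dots> \<le> M * M"
    using M by (intro mult_mono same) (auto simp: a_def b_def)
  finally have mixed: "a True * b False + a False * b True \<le> (F + 1 / F) * M"
    by (intro add_le_of_mult_le[OF assms(1) M diff diff]) simp_all
  have "real (card A) * real (card B) = (a True + a False) * (b True + b False)"
    by (simp add: A(1) B(1) a_def b_def)
  also have "\<dots> = a True * b True + a False * b False + (a True * b False + a False * b True)"
    by (simp add: algebra_simps)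
  also have "\<dots> \<le> M + M + (F + 1 / F) * M"
    by (intro add_mono same mixed)
  also have "\<dots> = C * M" by (simp add: C_def algebra_simps)
  also have "\<dots> = (2 + F + 1 / F) ^ Suc n * F powi (- d)" by (simp add: M_def C_def)
  finally show ?case .
qed

text \<open>
  For sets at distance \<open>j\<close> in dimension \<open>k * j\<close>, this is the number whose \<open>j\<close>-th power bounds
  the product of their densities. With \<open>F = 1 + \<epsilon>\<close> the base exceeds \<open>1\<close> by about \<open>\<epsilon>\<^sup>2 / 4\<close> only,
  while the separation gains the factor \<open>1 + \<epsilon>\<close>; so \<open>\<epsilon> = 1 / k\<close> is small enough.
\<close>
lemma separation_rate_less_1:
  fixes k :: nat
  assumes "k > 0"
  defines "F \<equiv> 1 + 1 / real k"
  shows "((2 + F + 1 / F) / 4) ^ k / F < 1"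
proof -
  define x :: real where "x = 1 / (4 * real k + 4)"
  have k: "real k > 0" using assms by simp
  have "(2 + F + 1 / F) / 4 = 1 + x / real k"
    using k by (simp add: F_def x_def divide_simps) algebra
  also have "\<dots> \<le> exp (x / real k)" by (rule exp_ge_add_one_self)
  finally have "((2 + F + 1 / F) / 4) ^ k \<le> exp (x / real k) ^ k"
    using k by (intro power_mono) (simp_all add: F_def)
  also have "\<dots> = exp x" using k by (simp flip: exp_of_nat_mult)
  also have "\<dots> < F"
  proof -
    have "1 - x \<le> exp (- x)" using exp_ge_add_one_self[of "- x"] by simp
    then have "exp x * (1 - x) \<le> 1" by (simp add: exp_minus field_simps)
    moreover have "1 < F * (1 - x)" using k by (simp add: F_def x_def divide_simps) (simp add: algebra_simps)
    moreover have "1 - x > 0" using k by (simp add: x_def divide_simps)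
    ultimately show ?thesis by (smt (verit) mult_right_mono)
  qed
  finally have "((2 + F + 1 / F) / 4) ^ k < F" .
  moreover have "F > 0" using k by (simp add: F_def add_pos_pos)
  ultimately show ?thesis by simp
qed

text \<open>
  Otherwise \<open>A\<close> and its set of complements would be separated by a fixed fraction \<open>1 / k\<close> of the dimension,
  so that the density of \<open>A\<close> would decay exponentially and eventually fall below \<open>1 / N\<close>.
\<close>
lemma large_subset_cube_nearly_antipodal:
  fixes k N :: nat
  assumes "k > 0"
  obtains n where "n > 0"
    and "\<And>A. A \<subseteq> cube n \<Longrightarrow> 2 ^ n \<le> N * card A \<Longrightarrow>
           \<exists>a\<in>A. \<exists>b\<in>A. k * (n - hamming a b) \<le> n"
proof -
  define F where "F = 1 + 1 / real k"
  \<comment> \<open>The dimension \<open>n = k * j\<close> is a multiple of \<open>k\<close>, so that the separation \<open>n / k\<close> is exactly \<open>j\<close>.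
    Taking \<open>j\<close> to be a successor keeps \<open>n\<close> positive.\<close>
  define r where "r = ((2 + F + 1 / F) / 4) ^ k / F"
  have F: "F \<ge> 1" by (simp add: F_def)
  then have r0: "r \<ge> 0" by (simp add: r_def)
  have r1: "r < 1"
    using separation_rate_less_1[OF assms] by (simp add: r_def F_def)
  obtain i where "r ^ i < 1 / (real N ^ 2 + 1)"
    using real_arch_pow_inv[of "1 / (real N ^ 2 + 1)" r] r1 by (auto simp: add_nonneg_pos)
  moreover have "r ^ Suc i \<le> r ^ i"
    using r0 r1 by (intro power_decreasing) auto
  ultimately have "r ^ Suc i < 1 / (real N ^ 2 + 1)" by linarith
  then have "(real N ^ 2 + 1) * r ^ Suc i < 1"
    by (subst (asm) less_divide_eq) (simp add: add_nonneg_pos mult.commute)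
  then have small: "real N ^ 2 * r ^ Suc i < 1"
    using zero_le_power[OF r0, of "Suc i"] by (simp add: algebra_simps)
  define j where "j = Suc i"
  define n where "n = k * j"
  have "\<exists>a\<in>A. \<exists>b\<in>A. k * (n - hamming a b) \<le> n" if A: "A \<subseteq> cube n" "2 ^ n \<le> N * card A" for A
  proof (rule ccontr)
    assume "\<not> ?thesis"
    then have far: "n < k * (n - hamming a b)" if "a \<in> A" "b \<in> A" for a b
      using that by (meson not_le)
    have "inj (map Not)" by (simp add: inj_on_def)
    then have card: "card (map Not ` A) = card A"
      by (intro card_image) (auto intro: inj_on_subset)
    have "real (card A) * real (card (map Not ` A)) \<le> (2 + F + 1 / F) ^ n * F powi (- int j)"
    proof (rule card_mult_separated_le[OF F])
      show "map Not ` A \<subseteq> cube n" using A(1) by (auto simp: cube_def)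
      fix a b assume "a \<in> A" "b \<in> map Not ` A"
      then obtain c where c: "c \<in> A" "b = map Not c" by auto
      have len: "length a = n" "length c = n"
        using A(1) \<open>a \<in> A\<close> c by (auto simp: cube_def)
      have "k * j < k * (n - hamming a c)"
        using far[OF \<open>a \<in> A\<close> c(1)] by (simp add: n_def)
      then have "j < n - hamming a c" by simp
      then show "int j \<le> int (hamming a b)"
        using hamming_map_Not[of a c] len c(2) by simp
    qed (rule A(1))
    also have "\<dots> = 4 ^ n * r ^ j"
      by (simp add: r_def n_def power_mult power_divide power_int_minus divide_simps)
    finally have bound: "real (card A) ^ 2 \<le> 4 ^ n * r ^ j"
      by (simp add: card power2_eq_square)
    have "2 ^ n \<le> real N * real (card A)"
      using A(2) by (metis of_nat_le_iff of_nat_mult of_nat_numeral of_nat_power)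
    then have "(2 ^ n) ^ 2 \<le> (real N * real (card A)) ^ 2"
      by (intro power_mono) auto
    also have "\<dots> \<le> real N ^ 2 * (4 ^ n * r ^ j)"
      using bound by (simp add: power_mult_distrib mult_left_mono)
    also have "(2 ^ n :: real) ^ 2 = 4 ^ n"
      by (simp add: power2_eq_square flip: power_mult_distrib)
    finally have "4 ^ n * 1 \<le> 4 ^ n * (real N ^ 2 * r ^ j)" by (simp add: mult_ac)
    then show False using small by (simp add: j_def)
  qed
  moreover have "n > 0" using assms by (simp add: n_def j_def)
  ultimately show ?thesis using that by blast
qed

section \<open>Finite colourings of the Hilbert sphere\<close>

lift_definition cube_vector :: "bool list \<Rightarrow> ell2" is
  "\<lambda>xs i. if i < length xs then (if xs ! i then 1 else - 1) / sqrt (real (length xs)) else 0"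
  by (rule summable_finite[of "{..<length xs}" for xs :: "bool list"]) auto

lemma sum_signs_eq:
  assumes "length xs = length ys"
  shows "(\<Sum>i<length xs. (if xs ! i then 1 else - 1) * (if ys ! i then 1 else - 1) :: real) =
         real (length xs) - 2 * real (hamming xs ys)"
  using assms
  by (induction xs ys rule: list_induct2) (auto simp: sum.lessThan_Suc_shift simp del: sum.lessThan_Suc)

lemma inner_cube_vector:
  assumes "length xs = n" "length ys = n" "n > 0"
  shows "inner (cube_vector xs) (cube_vector ys) = 1 - 2 * real (hamming xs ys) / real n"
proof -
  have "inner (cube_vector xs) (cube_vector ys) =
      (\<Sum>i. ell2_nth (cube_vector xs) i * ell2_nth (cube_vector ys) i)"
    by (simp add: inner_ell2.rep_eq)
  also have "\<dots> = (\<Sum>i<n. ell2_nth (cube_vector xs) i * ell2_nth (cube_vector ys) i)"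
    by (rule suminf_finite) (auto simp: cube_vector.rep_eq assms)
  also have "\<dots> = (\<Sum>i<n. (if xs ! i then 1 else - 1) * (if ys ! i then 1 else - 1) / real n)"
    by (rule sum.cong) (auto simp: cube_vector.rep_eq assms)
  also have "\<dots> = (real n - 2 * real (hamming xs ys)) / real n"
    using sum_signs_eq[of xs ys] assms by (simp flip: sum_divide_distrib)
  finally show ?thesis using assms by (simp add: field_simps)
qed

lemma cube_vector_in_sphere:
  assumes "xs \<in> cube n" "n > 0"
  shows "cube_vector xs \<in> sphere 0 1"
proof -
  have "hamming xs xs = 0" by (induction xs) auto
  then have "inner (cube_vector xs) (cube_vector xs) = 1"
    using assms by (simp add: inner_cube_vector[of _ n] cube_def)
  then show ?thesis by (simp add: norm_eq_1)
qed

text \<open>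
  The sign vectors of a high-dimensional cube already force this: by the pigeonhole
  principle some colour is too frequent on the cube to avoid nearly antipodal pairs.
\<close>
lemma finite_colouring_nearly_antipodal:
  fixes col :: "ell2 \<Rightarrow> 'c" and c :: real
  assumes "finite K" "\<And>y. y \<in> sphere 0 1 \<Longrightarrow> col y \<in> K" "0 \<le> c" "c < pi"
  obtains y y' where "y \<in> sphere 0 1" "y' \<in> sphere 0 1" "col y = col y'"
    "c < mdist unit_sphere y y'"
proof -
  \<comment> \<open>Sign vectors that agree in at most \<open>n / k\<close> places have inner product at most \<open>2 / k - 1\<close>,
    and this has to be less than \<open>cos c\<close>.\<close>
  have "cos pi < cos c" using assms by (intro cos_monotone_0_pi) auto
  then have "(1 + cos c) / 2 > 0" by simp
  then obtain k :: nat where k: "k > 0" "1 / real k < (1 + cos c) / 2"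
    by (metis nat_approx_posE zero_less_Suc)
  obtain n where n: "n > 0" "\<And>A. A \<subseteq> cube n \<Longrightarrow> 2 ^ n \<le> card K * card A \<Longrightarrow>
           \<exists>a\<in>A. \<exists>b\<in>A. k * (n - hamming a b) \<le> n"
    using large_subset_cube_nearly_antipodal[OF k(1)] by blast
  define cl where "cl z = {xs \<in> cube n. col (cube_vector xs) = z}" for z
  have "cube n = (\<Union>z\<in>K. cl z)"
    using assms(2) cube_vector_in_sphere n(1) by (auto simp: cl_def)
  then have "2 ^ n \<le> (\<Sum>z\<in>K. card (cl z))"
    using card_UN_le[OF assms(1), of cl] card_cube[of n] by simp
  have "\<exists>z\<in>K. 2 ^ n \<le> card K * card (cl z)"
  proof (rule ccontr)
    assume neg: "\<not> ?thesis"
    have "K \<noteq> {}" using \<open>2 ^ n \<le> _\<close> by auto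
    then have "(\<Sum>z\<in>K. card K * card (cl z)) < (\<Sum>z\<in>K. 2 ^ n)"
      using neg assms(1) by (intro sum_strict_mono) (auto simp: not_le)
    then have "card K * (\<Sum>z\<in>K. card (cl z)) < card K * 2 ^ n"
      by (simp add: sum_distrib_left)
    then show False using \<open>2 ^ n \<le> _\<close> by simp
  qed
  then obtain z where "2 ^ n \<le> card K * card (cl z)" by blast
  then obtain a b where ab: "a \<in> cl z" "b \<in> cl z" "k * (n - hamming a b) \<le> n"
    using n(2)[of "cl z"] by (auto simp: cl_def)
  have cube: "a \<in> cube n" "b \<in> cube n" using ab by (auto simp: cl_def)
  then have sph: "cube_vector a \<in> sphere 0 1" "cube_vector b \<in> sphere 0 1"
    using n(1) by (blast intro: cube_vector_in_sphere)+
  have "real n - real (hamming a b) \<le> real (n - hamming a b)" by linarith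
  also have "\<dots> \<le> real n / real k"
    using ab(3) k(1) by (simp add: pos_le_divide_eq mult.commute flip: of_nat_mult)
  finally have "1 - real (hamming a b) / real n \<le> 1 / real k"
    using n(1) k(1) by (simp add: field_simps)
  then have inner: "inner (cube_vector a) (cube_vector b) < cos c"
    using k(2) cube n(1) by (simp add: inner_cube_vector[of _ n] cube_def)
  have "c = arccos (cos c)" using assms by (simp add: arccos_cos)
  also have "\<dots> < arccos (inner (cube_vector a) (cube_vector b))"
    using inner abs_inner_unit_le_1[of "cube_vector a" "cube_vector b"] sph
    by (intro arccos_less_mono[THEN iffD2]) auto
  finally have "c < mdist unit_sphere (cube_vector a) (cube_vector b)"
    using sph by (simp add: mdist_unit_sphere)
  then show ?thesis using that sph ab by (auto simp: cl_def)
qed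

section \<open>Gromov-Hausdorff estimates\<close>

lemma mdist_unit_sphere_le_pi:
  assumes "x \<in> sphere 0 1" "y \<in> sphere 0 1"
  shows "mdist unit_sphere x y \<le> pi"
  using assms abs_inner_unit_le_1[of x y]
  by (auto simp: mdist_unit_sphere intro!: arccos_ubound)

text \<open>
  Total boundedness carries over from the Euclidean to the geodesic distance, because
  \<open>inner k x = 1 - (dist k x)\<^sup>2 / 2\<close> on the sphere: a chord shorter than
  \<open>sqrt (2 * (1 - cos t))\<close> subtends an angle less than \<open>t\<close>.
\<close>
lemma geodesic_net_exists:
  fixes e :: real
  assumes "e > 0"
  obtains K :: "'a::euclidean_space set" where "finite K" "K \<subseteq> sphere 0 1"
    "\<And>x. x \<in> sphere 0 1 \<Longrightarrow> \<exists>k\<in>K. mdist unit_sphere k x < e"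
proof -
  define t where "t = min e pi"
  have "cos t < cos 0"
    using assms by (intro cos_monotone_0_pi) (auto simp: t_def)
  define \<eta> where "\<eta> = sqrt (2 * (1 - cos t))"
  have "\<eta> > 0" using \<open>cos t < cos 0\<close> by (simp add: \<eta>_def)
  have "compact (sphere 0 1 :: 'a set)" by simp
  then obtain K :: "'a set" where K: "finite K" "K \<subseteq> sphere 0 1" "sphere 0 1 \<subseteq> (\<Union>x\<in>K. ball x \<eta>)"
    using \<open>\<eta> > 0\<close> unfolding compact_eq_totally_bounded
    by (metis compact_imp_seq_compact seq_compact_imp_totally_bounded compact_sphere)
  have "\<exists>k\<in>K. mdist unit_sphere k x < e" if x: "x \<in> sphere 0 1" for x
  proof -
    obtain k where k: "k \<in> K" "dist k x < \<eta>" using K(3) x by auto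
    have ks: "k \<in> sphere 0 1" using k K(2) by auto
    have "(dist k x)\<^sup>2 < \<eta>\<^sup>2" using k(2) by (intro power_strict_mono) auto
    also have "\<eta>\<^sup>2 = 2 * (1 - cos t)" by (simp add: \<eta>_def)
    also have "(dist k x)\<^sup>2 = 2 - 2 * inner k x"
      using x ks by (simp add: dist_norm power2_norm_eq_inner inner_diff_left inner_diff_right
          inner_commute norm_eq_1)
    finally have "cos t < inner k x" by simp
    then have "arccos (inner k x) < arccos (cos t)"
      using abs_inner_unit_le_1[of k x] x ks by (intro arccos_less_mono[THEN iffD2]) auto
    also have "arccos (cos t) = t" using assms by (intro arccos_cos) (auto simp: t_def)
    finally have "arccos (inner k x) < e" by (simp add: t_def)
    then show ?thesis using mdist_unit_sphere[OF ks x] k(1) by (intro bexI[of _ k]) simp_all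
  qed
  then show ?thesis using that K by blast
qed

text \<open>
  The bound \<open>D\<close> on the diameter of \<open>B\<close> keeps the supremum in the Hausdorff distance from being taken
  over an unbounded set of reals, where its value would be unspecified.
\<close>
lemma hausdorff_dist_less_imp_near:
  fixes Z :: "'a metric"
  assumes "A \<subseteq> mspace Z" "B \<subseteq> mspace Z" "A \<noteq> {}"
    and D: "\<And>b b'. b \<in> B \<Longrightarrow> b' \<in> B \<Longrightarrow> mdist Z b b' \<le> D"
    and "hausdorff_dist Z A B < r" "b \<in> B"
  shows "\<exists>a\<in>A. mdist Z a b < r"
proof -
  interpret Z: Metric_space "mspace Z" "mdist Z" by simp
  obtain a0 where a0: "a0 \<in> A" using assms by blast
  have bdd: "bdd_below ((\<lambda>a. mdist Z a y) ` A)" for y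
    by (rule bdd_belowI2[of _ 0]) simp
  have "bdd_above ((\<lambda>b. INF a\<in>A. mdist Z a b) ` B)"
  proof (rule bdd_aboveI2[of _ _ "mdist Z a0 b + D"])
    fix y assume y: "y \<in> B"
    have "(INF a\<in>A. mdist Z a y) \<le> mdist Z a0 y"
      by (rule cINF_lower[OF bdd a0])
    also have "\<dots> \<le> mdist Z a0 b + mdist Z b y"
      using a0 y assms by (intro Z.triangle) auto
    also have "mdist Z b y \<le> D" using D y assms by blast
    finally show "(INF a\<in>A. mdist Z a y) \<le> mdist Z a0 b + D" by simp
  qed
  then have "(INF a\<in>A. mdist Z a b) \<le> (SUP b\<in>B. INF a\<in>A. mdist Z a b)"
    using assms by (intro cSUP_upper) auto
  also have "\<dots> < r" using assms by (simp add: hausdorff_dist_def)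
  finally show ?thesis
    using cInf_lessD[of "(\<lambda>a. mdist Z a b) ` A" r] a0 by auto
qed

text \<open>
  A closer embedding would colour the Hilbert sphere by a finite net of the other sphere, with any
  two points of the same colour less than \<open>2 * s < \<pi>\<close> apart by the triangle inequality.
\<close>
lemma hausdorff_dist_spheres_ge:
  fixes Z :: "'c metric" and f :: "'a::euclidean_space \<Rightarrow> 'c" and g :: "ell2 \<Rightarrow> 'c"
  assumes f: "isometric_embedding f unit_sphere Z" and g: "isometric_embedding g unit_sphere Z"
  shows "pi / 2 \<le> hausdorff_dist Z (f ` sphere 0 1) (g ` sphere 0 1)"
proof (rule ccontr)
  assume "\<not> ?thesis"
  then obtain r where r: "hausdorff_dist Z (f ` sphere 0 1) (g ` sphere 0 1) < r" "r < pi / 2"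
    using dense[of _ "pi / 2"] by (auto simp: not_le)
  define s where "s = (r + pi / 2) / 2"
  have s: "r < s" "s < pi / 2" using r(2) by (simp_all add: s_def)
  interpret Z: Metric_space "mspace Z" "mdist Z" by simp
  have fZ: "f ` sphere 0 1 \<subseteq> mspace Z" and gZ: "g ` sphere 0 1 \<subseteq> mspace Z"
    using f g by (auto simp: isometric_embedding_def)
  have fd: "mdist Z (f x) (f x') = mdist unit_sphere x x'"
    if "x \<in> sphere 0 1" "x' \<in> sphere 0 1" for x x'
    using f that by (simp add: isometric_embedding_def)
  have gd: "mdist Z (g y) (g y') = mdist unit_sphere y y'"
    if "y \<in> sphere 0 1" "y' \<in> sphere 0 1" for y y'
    using g that by (simp add: isometric_embedding_def)
  obtain K :: "'a set" where K: "finite K" "K \<subseteq> sphere 0 1"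
    "\<And>x. x \<in> sphere 0 1 \<Longrightarrow> \<exists>k\<in>K. mdist unit_sphere k x < s - r"
    using geodesic_net_exists[of "s - r"] s by auto
  have near: "\<exists>k\<in>K. mdist Z (f k) (g y) < s" if y: "y \<in> sphere 0 1" for y
  proof -
    have "\<exists>a\<in>f ` sphere 0 1. mdist Z a (g y) < r"
      by (rule hausdorff_dist_less_imp_near[where D = pi, OF fZ gZ _ _ r(1)])
        (use y gd mdist_unit_sphere_le_pi in \<open>auto simp del: mem_sphere_0\<close>)
    then obtain x where x: "x \<in> sphere 0 1" "mdist Z (f x) (g y) < r" by blast
    obtain k where k: "k \<in> K" "mdist unit_sphere k x < s - r" using K(3) x(1) by blast
    have "mdist Z (f k) (g y) \<le> mdist Z (f k) (f x) + mdist Z (f x) (g y)"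
      using k(1) K(2) x(1) y fZ gZ by (intro Z.triangle) blast+
    also have "mdist Z (f k) (f x) = mdist unit_sphere k x"
      using k(1) K(2) x(1) by (intro fd) auto
    finally show ?thesis using x(2) k by force
  qed
  define col where "col y = (SOME k. k \<in> K \<and> mdist Z (f k) (g y) < s)" for y
  have col: "col y \<in> K" "mdist Z (f (col y)) (g y) < s" if "y \<in> sphere 0 1" for y
    using someI_ex[of "\<lambda>k. k \<in> K \<and> mdist Z (f k) (g y) < s"] near[OF that]
    by (auto simp: col_def)
  have "s \<ge> 0"
  proof -
    obtain y :: ell2 where "y \<in> sphere 0 1"
      using cube_vector_in_sphere[of "[True]" 1] by (auto simp: cube_def)
    then obtain k where "mdist Z (f k) (g y) < s" using near by blast
    then show ?thesis using Z.nonneg[of "f k" "g y"] by linarith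
  qed
  then have two: "0 \<le> 2 * s" "2 * s < pi" using s(2) by simp_all
  obtain y y' where y: "y \<in> sphere 0 1" "y' \<in> sphere 0 1" "col y = col y'"
    "2 * s < mdist unit_sphere y y'"
    using finite_colouring_nearly_antipodal[of K col "2 * s", OF K(1) col(1) two] by blast
  have "mdist unit_sphere y y' = mdist Z (g y) (g y')" using gd y by simp
  also have "\<dots> \<le> mdist Z (g y) (f (col y)) + mdist Z (f (col y)) (g y')"
    using y col(1)[of y] K(2) fZ gZ by (intro Z.triangle) blast+
  also have "\<dots> < s + s"
    using col(2)[OF y(1)] col(2)[OF y(2)] y(3) by (simp add: Z.commute)
  finally show False using y(4) by simp
qed

text \<open>
  The diameter bound \<open>2 * r\<close> is precisely the triangle inequality for two points of one part and a
  third point of the other.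
\<close>
lemma glue_at_constant_distance:
  fixes X :: "'a metric" and Y :: "'b metric" and r :: real
  assumes r: "r > 0" and ne: "mspace X \<noteq> {}" "mspace Y \<noteq> {}"
    and X: "\<And>x x'. x \<in> mspace X \<Longrightarrow> x' \<in> mspace X \<Longrightarrow> mdist X x x' \<le> 2 * r"
    and Y: "\<And>y y'. y \<in> mspace Y \<Longrightarrow> y' \<in> mspace Y \<Longrightarrow> mdist Y y y' \<le> 2 * r"
  obtains Z :: "('a + 'b) metric" where
    "isometric_embedding Inl X Z" "isometric_embedding Inr Y Z"
    "hausdorff_dist Z (Inl ` mspace X) (Inr ` mspace Y) = r"
proof -
  interpret X: Metric_space "mspace X" "mdist X" by simp
  interpret Y: Metric_space "mspace Y" "mdist Y" by simp
  define d where "d p q = (case (p, q) of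
      (Inl x, Inl x') \<Rightarrow> mdist X x x'
    | (Inr y, Inr y') \<Rightarrow> mdist Y y y'
    | _ \<Rightarrow> r)" for p q
  define S where "S = Inl ` mspace X \<union> Inr ` mspace Y"
  interpret D: Metric_space S d
  proof
    fix p q s
    show "0 \<le> d p q" using r by (auto simp: d_def split: sum.splits)
    show "d p q = d q p" by (auto simp: d_def X.commute Y.commute split: sum.splits)
    show "d p q = 0 \<longleftrightarrow> p = q" if "p \<in> S" "q \<in> S"
      using that r by (auto simp: d_def S_def)
    show "d p s \<le> d p q + d q s" if "p \<in> S" "q \<in> S" "s \<in> S"
      using that r X Y X.triangle Y.triangle by (auto simp: d_def S_def)
  qed
  define Z where "Z = metric (S, d)"
  have Z: "mspace Z = S" "mdist Z = d" by (simp_all add: Z_def)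
  have "hausdorff_dist Z (Inl ` mspace X) (Inr ` mspace Y) = r"
    using ne by (simp add: hausdorff_dist_def Z d_def image_image)
  moreover have "isometric_embedding Inl X Z" "isometric_embedding Inr Y Z"
    by (auto simp: isometric_embedding_def Z d_def S_def)
  ultimately show ?thesis using that by blast
qed

theorem proposition1p6:
  fixes m :: nat
  assumes "CARD('n::finite) = m + 1"
  shows "GH_dist (unit_sphere :: (real ^ 'n) metric) (unit_sphere :: ell2 metric) = pi / 2"
proof -
  have "(axis undefined 1 :: real ^ 'n) \<in> sphere 0 1" by (simp add: norm_axis_1)
  then have ne1: "mspace (unit_sphere :: (real ^ 'n) metric) \<noteq> {}" by auto
  have ne2: "mspace (unit_sphere :: ell2 metric) \<noteq> {}"
    using cube_vector_in_sphere[of "[True]" 1] by (auto simp: cube_def)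
  obtain Z :: "(real ^ 'n + ell2) metric" where Z:
    "isometric_embedding Inl unit_sphere Z" "isometric_embedding Inr unit_sphere Z"
    "hausdorff_dist Z (Inl ` mspace unit_sphere) (Inr ` mspace unit_sphere) = pi / 2"
    by (rule glue_at_constant_distance[OF _ ne1 ne2, of "pi / 2"])
      (use mdist_unit_sphere_le_pi in \<open>auto simp del: mem_sphere_0\<close>)
  show ?thesis
    unfolding GH_dist_def
  proof (rule cInf_eq_minimum)
    show "pi / 2 \<in> {hausdorff_dist Z (f ` mspace unit_sphere) (g ` mspace unit_sphere) |
        (Z :: (real ^ 'n + ell2) metric) (f :: real ^ 'n \<Rightarrow> _) (g :: ell2 \<Rightarrow> _).
        isometric_embedding f unit_sphere Z \<and> isometric_embedding g unit_sphere Z}"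
      using Z(1,2) Z(3)[symmetric] by blast
  qed (use hausdorff_dist_spheres_ge in \<open>auto simp only: mspace_unit_sphere\<close>)
qed

end
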